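(* Let $n\geq 0$ and let $A=(a_{ij})_{0\leq i,j\leq n}$ be a complex matrix with $a_{ij}=0$ for $i>j+1$ and $a_{ij}=1$ for $i=j+1$. Then $A$ can be reconstructed from the expansion of $\det_{\mathrm{right}}(uu^*-\tilde A)$; that is, if $A$ and $A'$ are two such matrices (of the same size) and the expansions $$\det_{\mathrm{right}}(uu^*-\tilde A)=(uu^* )^{n+1}+\sum_{p=1}^{n+1}\sum_{k=0}^{n-p+1}x_k^{(p)}u^p(uu^* )^k$$ of $\det_{\mathrm{right}}(uu^*-\tilde A)$ and of $\det_{\mathrm{right}}(uu^*-\tilde A')$ have the same coefficients $x^{(p)}_k\in\mathbb{C}$, then $A=A'$.
   Context: $R=\mathbb{C}[u,u^*]$ is the Weyl algebra: the non-commutative polynomial ring with centre $\mathbb{C}$ modulo $uu^*-u^*u=1$. For $A$ as in the claim, $\tilde A$ is the $(n+1)\times(n+1)$ matrix over $R$ with entries $\tilde A_{ij}=a_{ij}u^{j-i+1}$ for $i\leq j$, $\tilde A_{ij}=1$ for $i=j+1$, and $\tilde A_{ij}=0$ for $i>j+1$; $uu^*$ stands for $uu^*$ times the identity matrix. The right determinant of $M=(M_{ij})_{0\leq i,j\leq n}$ over an associative unital ring is $\det_{\mathrm{right}}(M)=\sum_\sigma \mathrm{sign}(\sigma)M_{\sigma(n),n}\cdots M_{\sigma(0),0}$, the sum over all permutations $\sigma$ of $\{0,\ldots,n\}$. An expansion of the displayed form always exists. *)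

theory Defs
  imports
    "HOL-Library.Poly_Mapping"
    "HOL-Combinatorics.Permutations"
    "Jordan_Normal_Form.Matrix"
    "HOL-Computational_Algebra.Polynomial"
begin

datatype weyl_gen = U | Ustar

text \<open>Words are a type of their own because the convolution product of finitely supported
  functions expects the monoid of exponents to be additive: addition of words is concatenation.\<close>

datatype weyl_word = Word "weyl_gen list"

instantiation weyl_word :: monoid_add
begin

definition zero_weyl_word :: weyl_word where
  "0 = Word []"

fun plus_weyl_word :: "weyl_word \<Rightarrow> weyl_word \<Rightarrow> weyl_word" where
  "Word v + Word w = Word (v @ w)"

instance
proof
  fix a b c :: weyl_word
  show "a + b + c = a + (b + c)"
    by (cases a; cases b; cases c) simp
  show "0 + a = a" "a + 0 = a"
    by (cases a; simp add: zero_weyl_word_def)+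
qed

end

type_synonym weyl_free = "weyl_word \<Rightarrow>\<^sub>0 complex"

definition free_gen :: "weyl_gen \<Rightarrow> weyl_free" where
  "free_gen g = Poly_Mapping.single (Word [g]) 1"

definition weyl_relator :: weyl_free where
  "weyl_relator = free_gen U * free_gen Ustar - free_gen Ustar * free_gen U - 1"

text \<open>The two-sided ideal generated by the relator; it is closed under negation
  because the factor \<open>a\<close> may be replaced by \<open>- a\<close>.\<close>

inductive_set weyl_ideal :: "weyl_free set" where
  zero: "0 \<in> weyl_ideal"
| add: "f \<in> weyl_ideal \<Longrightarrow> f + a * weyl_relator * b \<in> weyl_ideal"

lemma weyl_ideal_add:
  assumes "f \<in> weyl_ideal" "g \<in> weyl_ideal"
  shows "f + g \<in> weyl_ideal"
  using assms(2)
proof induction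
  case zero
  then show ?case using assms(1) by simp
next
  case (add g a b)
  then show ?case
    using weyl_ideal.add[of "f + g" a b] by (simp add: add.assoc)
qed

lemma weyl_ideal_mult_left:
  assumes "f \<in> weyl_ideal"
  shows "c * f \<in> weyl_ideal"
  using assms
proof induction
  case zero
  then show ?case by (simp add: weyl_ideal.zero)
next
  case (add f a b)
  then show ?case
    using weyl_ideal.add[of "c * f" "c * a" b] by (simp add: distrib_left mult.assoc)
qed

lemma weyl_ideal_mult_right:
  assumes "f \<in> weyl_ideal"
  shows "f * c \<in> weyl_ideal"
  using assms
proof induction
  case zero
  then show ?case by (simp add: weyl_ideal.zero)
next
  case (add f a b)
  then show ?case
    using weyl_ideal.add[of "f * c" a "b * c"] by (simp add: distrib_right mult.assoc)
qed

lemma weyl_ideal_uminus: "f \<in> weyl_ideal \<Longrightarrow> - f \<in> weyl_ideal"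
  using weyl_ideal_mult_left[of f "- 1"] by simp

lemma weyl_ideal_diff: "f \<in> weyl_ideal \<Longrightarrow> g \<in> weyl_ideal \<Longrightarrow> f - g \<in> weyl_ideal"
  using weyl_ideal_add[of f "- g"] weyl_ideal_uminus[of g] by simp

lemma weyl_relator_in_ideal: "weyl_relator \<in> weyl_ideal"
  using weyl_ideal.add[OF weyl_ideal.zero, of 1 1] by simp

text \<open>The ideal is proper: the free algebra acts on polynomials, with \<open>u\<close> acting as
  differentiation and \<open>u\<^sup>*\<close> as multiplication by the variable, and the ideal acts as zero.\<close>

fun gen_act :: "weyl_gen \<Rightarrow> complex poly \<Rightarrow> complex poly" where
  "gen_act U p = pderiv p"
| "gen_act Ustar p = pCons 0 p"

fun word_act :: "weyl_word \<Rightarrow> complex poly \<Rightarrow> complex poly" where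
  "word_act (Word w) p = foldr gen_act w p"

definition free_act :: "weyl_free \<Rightarrow> complex poly \<Rightarrow> complex poly" where
  "free_act f p = (\<Sum>w\<in>Poly_Mapping.keys f. smult (Poly_Mapping.lookup f w) (word_act w p))"

lemma gen_act_add: "gen_act g (p + q) = gen_act g p + gen_act g q"
  by (cases g) (simp_all add: pderiv_add)

lemma gen_act_smult: "gen_act g (smult c p) = smult c (gen_act g p)"
  by (cases g) (simp_all add: pderiv_smult)

lemma word_act_add: "word_act w (p + q) = word_act w p + word_act w q"
proof (cases w)
  case (Word v)
  have "foldr gen_act v (p + q) = foldr gen_act v p + foldr gen_act v q"
    by (induction v) (simp_all add: gen_act_add)
  then show ?thesis using Word by simp
qed

lemma word_act_smult: "word_act w (smult c p) = smult c (word_act w p)"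
proof (cases w)
  case (Word v)
  have "foldr gen_act v (smult c p) = smult c (foldr gen_act v p)"
    by (induction v) (simp_all add: gen_act_smult)
  then show ?thesis using Word by simp
qed

lemma word_act_plus: "word_act (v + w) p = word_act v (word_act w p)"
  by (cases v; cases w) simp

lemma free_act_superset:
  assumes "finite S" "Poly_Mapping.keys f \<subseteq> S"
  shows "free_act f p = (\<Sum>w\<in>S. smult (Poly_Mapping.lookup f w) (word_act w p))"
  unfolding free_act_def
  by (rule sum.mono_neutral_left) (use assms in \<open>auto simp: in_keys_iff\<close>)

lemma free_act_plus: "free_act (f + g) p = free_act f p + free_act g p"
proof -
  let ?S = "Poly_Mapping.keys f \<union> Poly_Mapping.keys g"
  have "Poly_Mapping.keys (f + g) \<subseteq> ?S"
    by (rule Poly_Mapping.keys_add)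
  then show ?thesis
    by (simp add: free_act_superset[of ?S] lookup_add smult_add_left sum.distrib)
qed

lemma free_act_zero [simp]: "free_act 0 p = 0"
  by (simp add: free_act_def)

lemma free_act_single [simp]: "free_act (Poly_Mapping.single w c) p = smult c (word_act w p)"
  by (simp add: free_act_superset[of "{w}"])

lemma free_act_add: "free_act f (p + q) = free_act f p + free_act f q"
  by (simp add: free_act_def word_act_add smult_add_right sum.distrib)

lemma free_act_of_zero [simp]: "free_act f 0 = 0"
  using free_act_add[of f 0 0] by simp

lemma free_act_smult: "free_act f (smult c p) = smult c (free_act f p)"
proof -
  have "smult c (\<Sum>w\<in>S. h w) = (\<Sum>w\<in>S. smult c (h w))" for S and h :: "weyl_word \<Rightarrow> complex poly"
    by (induction S rule: infinite_finite_induct) (simp_all add: smult_add_right)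
  then show ?thesis
    by (simp add: free_act_def word_act_smult mult.commute)
qed

lemma free_induct [case_names zero add]:
  assumes zero: "P 0"
    and add: "\<And>w c f. P f \<Longrightarrow> P (Poly_Mapping.single w c + f)"
  shows "P (f :: weyl_free)"
proof (induction f rule: update_induct)
  case const
  show ?case by (rule zero)
next
  case (update f w c)
  have "Poly_Mapping.update w c f = Poly_Mapping.single w c + f"
    using update(1)
    by (intro poly_mapping_eqI)
      (auto simp: lookup_update lookup_add lookup_single in_keys_iff when_def)
  then show ?case using add[OF update.IH] by simp
qed

lemma free_act_mult: "free_act (f * g) p = free_act f (free_act g p)"
proof (induction f rule: free_induct)
  case zero
  then show ?case by simp
next
  case (add w c f)
  have "free_act (Poly_Mapping.single w c * g) p =
    free_act (Poly_Mapping.single w c) (free_act g p)"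
  proof (induction g rule: free_induct)
    case zero
    then show ?case by simp
  next
    case (add v d g)
    then show ?case
      by (simp add: distrib_left free_act_plus mult_single word_act_plus word_act_smult
          word_act_add smult_add_right)
  qed
  then show ?case using add by (simp add: distrib_right free_act_plus)
qed

lemma free_act_diff: "free_act (f - g) p = free_act f p - free_act g p"
  using free_act_plus[of "f - g" g p] by simp

lemma free_act_one [simp]: "free_act 1 p = p"
  by (simp flip: single_one add: zero_weyl_word_def)

lemma free_act_relator: "free_act weyl_relator p = 0"
  by (simp add: weyl_relator_def free_act_diff free_act_mult free_gen_def pderiv_pCons)

lemma free_act_ideal: "f \<in> weyl_ideal \<Longrightarrow> free_act f p = 0"
  by (induction rule: weyl_ideal.induct)
    (simp_all add: free_act_plus free_act_mult free_act_relator)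

lemma one_notin_weyl_ideal: "1 \<notin> weyl_ideal"
  using free_act_ideal[of 1 1] by auto

definition weyl_rel :: "weyl_free \<Rightarrow> weyl_free \<Rightarrow> bool" where
  "weyl_rel f g \<longleftrightarrow> f - g \<in> weyl_ideal"

lemma equivp_weyl_rel: "equivp weyl_rel"
proof (rule equivpI)
  show "reflp weyl_rel"
    by (simp add: reflp_def weyl_rel_def weyl_ideal.zero)
  show "symp weyl_rel"
    using weyl_ideal_uminus by (fastforce simp: symp_def weyl_rel_def)
  show "transp weyl_rel"
    using weyl_ideal_add by (fastforce simp: transp_def weyl_rel_def)
qed

quotient_type weyl = weyl_free / weyl_rel
  by (rule equivp_weyl_rel)

instantiation weyl :: ring_1
begin

lift_definition zero_weyl :: weyl is "0 :: weyl_free" .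

lift_definition one_weyl :: weyl is "1 :: weyl_free" .

lift_definition plus_weyl :: "weyl \<Rightarrow> weyl \<Rightarrow> weyl" is "(+) :: weyl_free \<Rightarrow> _"
  unfolding weyl_rel_def by (metis add_diff_add weyl_ideal_add)

lift_definition uminus_weyl :: "weyl \<Rightarrow> weyl" is "uminus :: weyl_free \<Rightarrow> _"
  unfolding weyl_rel_def by (metis minus_diff_minus weyl_ideal_uminus)

lift_definition minus_weyl :: "weyl \<Rightarrow> weyl \<Rightarrow> weyl" is "(-) :: weyl_free \<Rightarrow> _"
proof -
  fix f f' g g' :: weyl_free
  assume "weyl_rel f f'" "weyl_rel g g'"
  then have "(f - f') - (g - g') \<in> weyl_ideal"
    unfolding weyl_rel_def by (rule weyl_ideal_diff)
  then show "weyl_rel (f - g) (f' - g')"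
    unfolding weyl_rel_def by (simp add: algebra_simps)
qed

lift_definition times_weyl :: "weyl \<Rightarrow> weyl \<Rightarrow> weyl" is "(*) :: weyl_free \<Rightarrow> _"
proof -
  fix f f' g g' :: weyl_free
  assume "weyl_rel f f'" "weyl_rel g g'"
  then have "(f - f') * g + f' * (g - g') \<in> weyl_ideal"
    unfolding weyl_rel_def
    by (intro weyl_ideal_add weyl_ideal_mult_left weyl_ideal_mult_right)
  then show "weyl_rel (f * g) (f' * g')"
    unfolding weyl_rel_def by (simp add: algebra_simps)
qed

instance
proof
  fix a b c :: weyl
  have refl: "weyl_rel f f" for f
    by (simp add: weyl_rel_def weyl_ideal.zero)
  show "a + b + c = a + (b + c)" by transfer (simp add: add.assoc refl)
  show "a + b = b + a" by transfer (simp add: add.commute refl)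
  show "0 + a = a" by transfer (simp add: refl)
  show "- a + a = 0" by transfer (simp add: refl)
  show "a - b = a + - b" by transfer (simp add: refl)
  show "a * b * c = a * (b * c)" by transfer (simp add: mult.assoc refl)
  show "1 * a = a" "a * 1 = a" by (transfer; simp add: refl)+
  show "(a + b) * c = a * c + b * c" by transfer (simp add: distrib_right refl)
  show "a * (b + c) = a * b + a * c" by transfer (simp add: distrib_left refl)
  show "(0 :: weyl) \<noteq> 1"
    by transfer (use weyl_ideal_uminus[of "- 1"] one_notin_weyl_ideal in \<open>auto simp: weyl_rel_def\<close>)
qed

end

lift_definition weyl_const :: "complex \<Rightarrow> weyl" is "\<lambda>c. Poly_Mapping.single 0 c" .

lift_definition weyl_u :: weyl is "free_gen U" .

lift_definition weyl_ustar :: weyl is "free_gen Ustar" .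

lemma weyl_relation: "weyl_u * weyl_ustar - weyl_ustar * weyl_u = 1"
  by transfer (use weyl_relator_in_ideal in \<open>simp add: weyl_rel_def weyl_relator_def\<close>)

lemma weyl_const_central: "weyl_const c * a = a * weyl_const c"
proof transfer
  fix c and f :: weyl_free
  have "Poly_Mapping.single 0 c * f = f * Poly_Mapping.single 0 c"
    by (induction f rule: free_induct)
      (simp_all add: distrib_left distrib_right mult_single mult.commute)
  then show "weyl_rel (Poly_Mapping.single 0 c * f) (f * Poly_Mapping.single 0 c)"
    by (simp add: weyl_rel_def weyl_ideal.zero)
qed

text \<open>The factors are multiplied with decreasing column index from left to right.\<close>

definition det_right :: "'a :: ring_1 mat \<Rightarrow> 'a" where
  "det_right M = (\<Sum>\<sigma> | \<sigma> permutes {0..<dim_col M}.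
     of_int (sign \<sigma>) * prod_list (map (\<lambda>j. M $$ (\<sigma> j, j)) (rev [0..<dim_col M])))"

definition unit_hessenberg :: "'a :: {zero, one} mat \<Rightarrow> bool" where
  "unit_hessenberg A \<longleftrightarrow> square_mat A \<and>
     (\<forall>i < dim_row A. \<forall>j < dim_col A.
       (i > j + 1 \<longrightarrow> A $$ (i, j) = 0) \<and> (i = j + 1 \<longrightarrow> A $$ (i, j) = 1))"

definition weyl_mat :: "complex mat \<Rightarrow> weyl mat" where
  "weyl_mat A = mat (dim_row A) (dim_col A) (\<lambda>(i, j).
     if i \<le> j then weyl_const (A $$ (i, j)) * weyl_u ^ (j - i + 1)
     else if i = j + 1 then 1 else 0)"

definition weyl_expansion :: "nat \<Rightarrow> (nat \<Rightarrow> nat \<Rightarrow> complex) \<Rightarrow> weyl" where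
  "weyl_expansion n x = (weyl_u * weyl_ustar) ^ (n + 1) +
     (\<Sum>p = 1..n + 1. \<Sum>k = 0..n + 1 - p. weyl_const (x p k) * weyl_u ^ p * (weyl_u * weyl_ustar) ^ k)"

end

theory Submission
  imports Defs
begin

text \<open>
  Write \<open>t = u u\<^sup>*\<close> and let \<open>D\<^sub>m\<close> be the right determinant of the leading \<open>m \<times> m\<close> block of
  \<open>t - \<tilde>A\<close>. Equal coefficients make the two full determinants equal, so the claim is that
  \<open>D\<^sub>n\<^sub>+\<^sub>1\<close> determines the entries \<open>a\<^sub>i\<^sub>j\<close> with \<open>i \<le> j\<close>.

  Because the subdiagonal is \<open>-1\<close> and everything below it vanishes, the determinant unfolds along
  its last column, whose factor stands leftmost, into the recursion (\<open>lead_det_Suc\<close>)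
  \<open>D\<^sub>m\<^sub>+\<^sub>1 = t D\<^sub>m - (\<Sum>i\<le>m. a\<^sub>i\<^sub>m u\<^sup>m\<^sup>+\<^sup>1\<^sup>-\<^sup>i D\<^sub>i)\<close>.

  By \<open>t u = u (t - 1)\<close> one can write \<open>D\<^sub>m = (\<Sum>p. u\<^sup>p d\<^sub>m\<^sub>,\<^sub>p(t))\<close> with complex polynomials \<open>d\<^sub>m\<^sub>,\<^sub>p\<close>,
  and the recursion becomes one in the commutative ring of polynomials in \<open>z\<close>:
  \<open>d\<^sub>m\<^sub>+\<^sub>1\<^sub>,\<^sub>p = (z - p) d\<^sub>m\<^sub>,\<^sub>p - (\<Sum>i. a\<^sub>i\<^sub>m d\<^sub>i\<^sub>,\<^sub>p\<^sub>-\<^sub>(\<^sub>m\<^sub>+\<^sub>1\<^sub>-\<^sub>i\<^sub>))\<close>.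
  The \<open>d\<^sub>m\<^sub>,\<^sub>p\<close> can be read off from \<open>D\<^sub>m\<close> because in the representation of \<open>u\<close> as differentiation
  and \<open>u\<^sup>*\<close> as multiplication by \<open>X\<close>, the monomial \<open>X\<^sup>s\<close> is an eigenvector of \<open>t\<close> with eigenvalue
  \<open>s + 1\<close>, so that the values \<open>d\<^sub>m\<^sub>,\<^sub>p(s + 1)\<close> for all \<open>s \<ge> p\<close> are visible as coefficients
  (\<open>coeff_lead_det_act\<close>, \<open>det_symbol_determined\<close>).

  Finally the diagonals \<open>j - i + 1 = p\<close> are recovered one after the other
  (\<open>det_symbol_determines_entries\<close>). If two matrices agree on all diagonals below the \<open>p\<close>-th,
  then the difference \<open>e\<^sub>m\<close> of their \<open>d\<^sub>m\<^sub>,\<^sub>p\<close> satisfies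
  \<open>e\<^sub>m\<^sub>+\<^sub>1 = (z - p) e\<^sub>m - \<delta> z\<^sup>m\<^sup>+\<^sup>1\<^sup>-\<^sup>p\<close>, where \<open>\<delta>\<close> is the difference of the entries in column \<open>m\<close> of
  the \<open>p\<close>-th diagonal. If \<open>e\<^sub>m\<^sub>+\<^sub>1 = 0\<close>, then evaluation at \<open>z = p \<noteq> 0\<close> gives \<open>\<delta> = 0\<close>, and
  cancelling \<open>z - p\<close> gives \<open>e\<^sub>m = 0\<close>; so one descends from \<open>m = n\<close> to \<open>m = 0\<close>.
\<close>

section \<open>Right determinants of Hessenberg matrices\<close>

lemma det_right_mat:
  "det_right (mat n n (\<lambda>(i, j). f i j)) =
    (\<Sum>\<sigma> | \<sigma> permutes {0..<n}. of_int (sign \<sigma>) * prod_list (map (\<lambda>j. f (\<sigma> j) j) (rev [0..<n])))"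
  unfolding det_right_def
proof (rule sum.cong, goal_cases)
  case (2 \<sigma>)
  then have \<sigma>: "\<sigma> permutes {0..<n}" by simp
  have "\<sigma> j < n" if "j < n" for j
    using permutes_in_image[OF \<sigma>, of j] that by simp
  then show ?case
    by (intro arg_cong2[of _ _ _ _ "(*)"] arg_cong[of _ _ prod_list] map_cong) auto
qed simp

lemma prod_list_eq_zero: "0 \<in> set xs \<Longrightarrow> prod_list xs = (0 :: 'a :: ring_1)"
  by (induction xs) auto

text \<open>The bottom row meets only the last two columns. A permutation that sends the last column to
  the bottom row contributes to the first summand. One that sends the last but one column there
  becomes, after composition with the transposition of the two columns, a permutation for the
  smaller matrix in which \<open>c\<close> has moved one column to the left; the sign of the transposition
  cancels the entry \<open>-1\<close>. Every other permutation meets a zero of the bottom row.\<close>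

lemma det_right_replace_last_column_Suc:
  fixes f :: "nat \<Rightarrow> nat \<Rightarrow> 'a :: ring_1"
  assumes below: "\<And>i j. i > j + 1 \<Longrightarrow> f i j = 0"
    and subdiag: "\<And>j. f (Suc j) j = -1"
  shows "det_right (mat (Suc (Suc n)) (Suc (Suc n)) (\<lambda>(i, j). if j = Suc n then c i else f i j)) =
    c (Suc n) * det_right (mat (Suc n) (Suc n) (\<lambda>(i, j). f i j)) +
    det_right (mat (Suc n) (Suc n) (\<lambda>(i, j). if j = n then c i else f i j))"
proof -
  define P where "P \<sigma> = prod_list (map (\<lambda>j. f (\<sigma> j) j) (rev [0..<n]))" for \<sigma> :: "nat \<Rightarrow> nat"
  define T where "T \<sigma> = of_int (sign \<sigma>) * (c (\<sigma> (Suc n)) * (f (\<sigma> n) n * P \<sigma>))"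
    for \<sigma> :: "nat \<Rightarrow> nat"
  define swp where "swp \<tau> = \<tau> \<circ> transpose n (Suc n)" for \<tau> :: "nat \<Rightarrow> nat"
  define S where "S = {\<sigma>. \<sigma> permutes {0..<Suc (Suc n)}}"
  define S1 where "S1 = {\<sigma>. \<sigma> permutes {0..<Suc n}}"
  have P_cong: "prod_list (map (\<lambda>j. if j = k then c (\<sigma> j) else f (\<sigma> j) j) (rev [0..<n])) = P \<sigma>"
    if "k \<ge> n" for k \<sigma>
    unfolding P_def using that by (intro arg_cong[of _ _ prod_list] map_cong) auto
  have lhs: "det_right (mat (Suc (Suc n)) (Suc (Suc n))
      (\<lambda>(i, j). if j = Suc n then c i else f i j)) = sum T S"
    unfolding det_right_mat S_def T_def
    by (intro sum.cong) (simp_all add: P_cong)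
  have D: "det_right (mat (Suc n) (Suc n) (\<lambda>(i, j). f i j)) =
      (\<Sum>\<sigma>\<in>S1. of_int (sign \<sigma>) * (f (\<sigma> n) n * P \<sigma>))"
    unfolding det_right_mat S1_def P_def by simp
  have E: "det_right (mat (Suc n) (Suc n) (\<lambda>(i, j). if j = n then c i else f i j)) =
      (\<Sum>\<sigma>\<in>S1. of_int (sign \<sigma>) * (c (\<sigma> n) * P \<sigma>))"
    unfolding det_right_mat S1_def by (simp add: P_cong)
  have fin: "finite S" "finite S1"
    unfolding S_def S1_def by (simp_all add: finite_permutations)
  have S1S: "S1 \<subseteq> S"
    unfolding S_def S1_def by (auto intro: permutes_subset)
  have fix_top: "\<sigma> (Suc n) = Suc n" if "\<sigma> \<in> S1" for \<sigma>
    using that by (auto simp: S1_def permutes_def)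
  have tr: "transpose n (Suc n) permutes {0..<Suc (Suc n)}"
    by (rule permutes_swap_id) auto
  have swp_S: "swp \<sigma> \<in> S" if "\<sigma> \<in> S" for \<sigma>
    using permutes_compose[OF tr, of \<sigma>] that by (simp add: S_def swp_def)
  have swp_swp: "swp (swp \<sigma>) = \<sigma>" for \<sigma>
    by (simp add: swp_def comp_assoc)
  have disj: "S1 \<inter> swp ` S1 = {}"
  proof (rule ccontr)
    assume "S1 \<inter> swp ` S1 \<noteq> {}"
    then obtain \<tau> where \<tau>: "\<tau> \<in> S1" "swp \<tau> \<in> S1" by auto
    have "swp \<tau> n = Suc n"
      using fix_top[OF \<tau>(1)] by (simp add: swp_def)
    moreover have "swp \<tau> n \<in> {0..<Suc n}"
      using \<tau>(2) permutes_in_image[of "swp \<tau>" "{0..<Suc n}" n] by (simp add: S1_def)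
    ultimately show False by simp
  qed
  have S1I: "\<sigma> \<in> S1" if "\<sigma> \<in> S" "\<sigma> (Suc n) = Suc n" for \<sigma>
    using that unfolding S_def S1_def
    by (auto intro!: permutes_superset[of \<sigma> "{0..<Suc (Suc n)}"] simp: less_Suc_eq)
  have vanish: "T \<sigma> = 0" if \<sigma>: "\<sigma> \<in> S - (S1 \<union> swp ` S1)" for \<sigma>
  proof -
    have per: "\<sigma> permutes {0..<Suc (Suc n)}" using \<sigma> by (simp add: S_def)
    obtain j where j: "\<sigma> j = Suc n"
      using permutes_surj[OF per] by (metis surjD)
    have "j \<noteq> Suc n" using S1I[of \<sigma>] \<sigma> j by auto
    moreover have "j \<noteq> n"
    proof
      assume "j = n"
      then have "swp \<sigma> \<in> S1"
        using \<sigma> j by (intro S1I swp_S) (auto simp: swp_def)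
      then show False using \<sigma> swp_swp[of \<sigma>] by (metis DiffD2 UnI2 image_eqI)
    qed
    moreover have "j < Suc (Suc n)"
      using permutes_in_image[OF per, of j] j by simp
    ultimately have "j < n" by simp
    then have "f (\<sigma> j) j = 0" using below[of j "\<sigma> j"] j by simp
    then have "P \<sigma> = 0"
      unfolding P_def using \<open>j < n\<close> by (intro prod_list_eq_zero) (force simp: image_iff)
    then show ?thesis by (simp add: T_def)
  qed
  have T1: "T \<sigma> = c (Suc n) * (of_int (sign \<sigma>) * (f (\<sigma> n) n * P \<sigma>))" if "\<sigma> \<in> S1" for \<sigma>
    unfolding T_def fix_top[OF that] by (metis mult.assoc mult_of_int_commute)
  have T2: "T (swp \<sigma>) = of_int (sign \<sigma>) * (c (\<sigma> n) * P \<sigma>)" if "\<sigma> \<in> S1" for \<sigma>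
  proof -
    have "permutation \<sigma>" using that by (auto simp: S1_def permutation_permutes)
    then have "sign (swp \<sigma>) = - sign \<sigma>"
      by (simp add: swp_def sign_compose permutation_swap_id sign_swap_id)
    moreover have "P (swp \<sigma>) = P \<sigma>"
      unfolding P_def swp_def
      by (intro arg_cong[of _ _ prod_list] map_cong) (auto simp: transpose_def)
    moreover have "swp \<sigma> n = Suc n" "swp \<sigma> (Suc n) = \<sigma> n"
      using fix_top[OF that] by (simp_all add: swp_def)
    ultimately show ?thesis by (simp add: T_def subdiag)
  qed
  have "sum T S = sum T (S1 \<union> swp ` S1)"
    using fin S1S swp_S vanish by (intro sum.mono_neutral_right) auto
  also have "\<dots> = sum T S1 + sum T (swp ` S1)"
    using fin disj by (intro sum.union_disjoint) auto
  also have "sum T (swp ` S1) = (\<Sum>\<sigma>\<in>S1. T (swp \<sigma>))"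
    by (subst sum.reindex) (auto intro: inj_on_inverseI swp_swp)
  also have "sum T S1 = c (Suc n) * (\<Sum>\<sigma>\<in>S1. of_int (sign \<sigma>) * (f (\<sigma> n) n * P \<sigma>))"
    by (simp add: T1 sum_distrib_left)
  finally show ?thesis
    unfolding lhs D E by (simp add: T2)
qed

lemma det_right_replace_last_column:
  fixes f :: "nat \<Rightarrow> nat \<Rightarrow> 'a :: ring_1"
  assumes "\<And>i j. i > j + 1 \<Longrightarrow> f i j = 0" and "\<And>j. f (Suc j) j = -1"
  shows "det_right (mat (Suc n) (Suc n) (\<lambda>(i, j). if j = n then c i else f i j)) =
    (\<Sum>i\<le>n. c i * det_right (mat i i (\<lambda>(i, j). f i j)))"
proof (induction n)
  case 0
  then show ?case by (simp add: det_right_mat)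
next
  case (Suc n)
  then show ?case
    using det_right_replace_last_column_Suc[of f n c, OF assms] by (simp add: add.commute)
qed

lemma det_right_hessenberg:
  fixes f :: "nat \<Rightarrow> nat \<Rightarrow> 'a :: ring_1"
  assumes "\<And>i j. i > j + 1 \<Longrightarrow> f i j = 0" and "\<And>j. f (Suc j) j = -1"
  shows "det_right (mat (Suc n) (Suc n) (\<lambda>(i, j). f i j)) =
    (\<Sum>i\<le>n. f i n * det_right (mat i i (\<lambda>(i, j). f i j)))"
proof -
  have "(\<lambda>(i, j). f i j) = (\<lambda>(i, j). if j = n then f i n else f i j)"
    by auto
  then show ?thesis
    using det_right_replace_last_column[of f n "\<lambda>i. f i n", OF assms] by simp
qed

text \<open>The entries are given by a function on all pairs of indices, so that the blocks of all sizes
  come from one object and the recursion below has no side conditions.\<close>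

definition lead_det :: "(nat \<Rightarrow> nat \<Rightarrow> complex) \<Rightarrow> nat \<Rightarrow> weyl" where
  "lead_det a m = det_right (mat m m (\<lambda>(i, j). (if i = j then weyl_u * weyl_ustar else 0) -
     (if i \<le> j then weyl_const (a i j) * weyl_u ^ (j - i + 1) else if i = j + 1 then 1 else 0)))"

lemma lead_det_0: "lead_det a 0 = 1"
  by (simp add: lead_det_def det_right_def)

lemma lead_det_Suc:
  "lead_det a (Suc m) = weyl_u * weyl_ustar * lead_det a m -
     (\<Sum>i\<le>m. weyl_const (a i m) * weyl_u ^ (m + 1 - i) * lead_det a i)"
proof -
  have "lead_det a (Suc m) =
    (\<Sum>i\<le>m. ((if i = m then weyl_u * weyl_ustar else 0) -
        weyl_const (a i m) * weyl_u ^ (m + 1 - i)) * lead_det a i)"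
    unfolding lead_det_def
    by (subst det_right_hessenberg) (auto intro!: sum.cong simp: Suc_diff_le)
  also have "\<dots> = (\<Sum>i\<le>m. (if i = m then weyl_u * weyl_ustar * lead_det a m else 0) -
        weyl_const (a i m) * weyl_u ^ (m + 1 - i) * lead_det a i)"
    by (intro sum.cong) (auto simp: left_diff_distrib)
  finally show ?thesis
    by (simp add: sum_subtractf)
qed

lemma det_right_weyl_mat:
  assumes "A \<in> carrier_mat m m"
  shows "det_right ((weyl_u * weyl_ustar) \<cdot>\<^sub>m 1\<^sub>m m - weyl_mat A) = lead_det (\<lambda>i j. A $$ (i, j)) m"
  unfolding lead_det_def using assms
  by (intro arg_cong[of _ _ det_right] eq_matI) (auto simp: weyl_mat_def)

section \<open>Action of the Weyl algebra on polynomials\<close>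

lift_definition weyl_act :: "weyl \<Rightarrow> complex poly \<Rightarrow> complex poly" is free_act
proof
  fix f g :: weyl_free and p
  assume "weyl_rel f g"
  then have "free_act (f - g) p = 0"
    unfolding weyl_rel_def by (rule free_act_ideal)
  then show "free_act f p = free_act g p"
    by (simp add: free_act_diff)
qed

lemma weyl_act_0 [simp]: "weyl_act 0 p = 0"
  by transfer simp

lemma weyl_act_1 [simp]: "weyl_act 1 p = p"
  by transfer simp

lemma weyl_act_add: "weyl_act (f + g) p = weyl_act f p + weyl_act g p"
  by transfer (rule free_act_plus)

lemma weyl_act_diff: "weyl_act (f - g) p = weyl_act f p - weyl_act g p"
  by transfer (rule free_act_diff)

lemma weyl_act_mult: "weyl_act (f * g) p = weyl_act f (weyl_act g p)"
  by transfer (rule free_act_mult)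

lemma weyl_act_sum: "weyl_act (\<Sum>i\<in>I. f i) p = (\<Sum>i\<in>I. weyl_act (f i) p)"
  by (induction I rule: infinite_finite_induct) (simp_all add: weyl_act_add)

lemma weyl_act_const: "weyl_act (weyl_const c) p = smult c p"
  by transfer (simp add: zero_weyl_word_def)

lemma weyl_act_u: "weyl_act weyl_u p = pderiv p"
  by transfer (simp add: free_gen_def)

lemma weyl_act_ustar: "weyl_act weyl_ustar p = pCons 0 p"
  by transfer (simp add: free_gen_def)

lemma coeff_weyl_act_u_ustar:
  "coeff (weyl_act (weyl_u * weyl_ustar) p) k = of_nat (Suc k) * coeff p k"
  by (simp add: weyl_act_mult weyl_act_u weyl_act_ustar coeff_pderiv)

lemma coeff_weyl_act_u_power:
  "fact k * coeff (weyl_act (weyl_u ^ q) p) k = fact (k + q) * coeff p (k + q)"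
proof (induction q arbitrary: k)
  case 0
  then show ?case by simp
next
  case (Suc q)
  have "fact k * coeff (weyl_act (weyl_u ^ Suc q) p) k =
      fact (Suc k) * coeff (weyl_act (weyl_u ^ q) p) (Suc k)"
    by (simp add: weyl_act_mult weyl_act_u coeff_pderiv mult_ac)
  also have "\<dots> = fact (k + Suc q) * coeff p (k + Suc q)"
    using Suc[of "Suc k"] by simp
  finally show ?case .
qed

section \<open>Commutative form of the determinant\<close>

text \<open>The polynomial \<open>d\<^sub>m\<^sub>,\<^sub>p\<close> in the normal form \<open>(\<Sum>p. u\<^sup>p d\<^sub>m\<^sub>,\<^sub>p(t))\<close> of the leading determinant
  \<open>D\<^sub>m\<close>; the factor \<open>z - p\<close> comes from \<open>t u\<^sup>p = u\<^sup>p (t - p)\<close>.\<close>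

fun det_symbol :: "(nat \<Rightarrow> nat \<Rightarrow> complex) \<Rightarrow> nat \<Rightarrow> nat \<Rightarrow> complex poly" where
  "det_symbol a 0 p = (if p = 0 then 1 else 0)"
| "det_symbol a (Suc m) p = [:- of_nat p, 1:] * det_symbol a m p -
     (\<Sum>i\<le>m. if m + 1 - i \<le> p then smult (a i m) (det_symbol a i (p - (m + 1 - i))) else 0)"

text \<open>The factorials absorb the coefficient \<open>s! / (s - p)!\<close> that \<open>u\<^sup>p\<close> produces from \<open>X\<^sup>s\<close>. The
  vanishing for \<open>k > s\<close> belongs to the induction: it disposes of the terms in which \<open>u\<^sup>q\<close> reaches
  above the degree of its argument.\<close>

lemma coeff_lead_det_act:
  "fact k * coeff (weyl_act (lead_det a m) (monom 1 s)) k =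
    (if k \<le> s then fact s * poly (det_symbol a m (s - k)) (of_nat (Suc s)) else 0)"
proof (induction m arbitrary: k rule: less_induct)
  case (less m)
  show ?case
  proof (cases m)
    case 0
    then show ?thesis by (auto simp: lead_det_0)
  next
    case (Suc l)
    let ?v = "\<lambda>i. weyl_act (lead_det a i) (monom 1 s)"
    define w where "w i = fact k * coeff (weyl_act (weyl_u ^ (l + 1 - i)) (?v i)) k" for i
    have coeff: "fact k * coeff (?v m) k =
        of_nat (Suc k) * (fact k * coeff (?v l) k) - (\<Sum>i\<le>l. a i l * w i)"
      unfolding Suc lead_det_Suc w_def
      by (simp only: weyl_act_diff weyl_act_sum weyl_act_mult[of _ "lead_det _ _"]
          weyl_act_mult[of "weyl_const _"] weyl_act_const
          coeff_diff coeff_sum coeff_smult coeff_weyl_act_u_ustar)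
        (simp add: algebra_simps sum_distrib_left)
    have w: "w i = (if k + (l + 1 - i) \<le> s then
        fact s * poly (det_symbol a i (s - (k + (l + 1 - i)))) (of_nat (Suc s)) else 0)"
      if "i \<le> l" for i
      unfolding w_def coeff_weyl_act_u_power using that Suc by (intro less.IH) simp
    have v: "fact k * coeff (?v l) k =
        (if k \<le> s then fact s * poly (det_symbol a l (s - k)) (of_nat (Suc s)) else 0)"
      using Suc by (intro less.IH) simp
    show ?thesis
    proof (cases "k \<le> s")
      case False
      then have "(\<Sum>i\<le>l. a i l * w i) = 0"
        by (intro sum.neutral) (auto simp: w)
      then show ?thesis unfolding coeff v using False by simp
    next
      case True
      have "(\<Sum>i\<le>l. a i l * w i) = fact s * (\<Sum>i\<le>l. poly (if l + 1 - i \<le> s - k then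
          smult (a i l) (det_symbol a i (s - k - (l + 1 - i))) else 0) (of_nat (Suc s)))"
        unfolding sum_distrib_left
      proof (rule sum.cong, goal_cases)
        case (2 i)
        have "k + (l + 1 - i) \<le> s \<longleftrightarrow> l + 1 - i \<le> s - k"
          "s - (k + (l + 1 - i)) = s - k - (l + 1 - i)"
          using True by linarith+
        then show ?case using 2 by (simp only: w atMost_iff) simp
      qed simp
      then show ?thesis
        unfolding coeff v using True
        by (simp add: Suc poly_sum of_nat_diff algebra_simps)
    qed
  qed
qed

lemma det_symbol_determined:
  assumes "lead_det a m = lead_det b m"
  shows "det_symbol a m p = det_symbol b m p"
proof -
  let ?d = "det_symbol a m p - det_symbol b m p"
  have "poly ?d (of_nat (Suc s)) = 0" if "p \<le> s" for s
    using coeff_lead_det_act[of "s - p" a m s] coeff_lead_det_act[of "s - p" b m s] assms that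
    by simp
  then have "(\<lambda>s. of_nat (Suc s)) ` {p..} \<subseteq> {z. poly ?d z = 0}"
    by auto
  moreover have "infinite ((\<lambda>s. of_nat (Suc s) :: complex) ` {p..})"
    by (subst finite_image_iff) (auto simp: inj_on_def infinite_Ici)
  ultimately have "?d = 0"
    using poly_roots_finite[of ?d] finite_subset by blast
  then show ?thesis by simp
qed

section \<open>Recovering the matrix diagonal by diagonal\<close>

lemma det_symbol_0_right: "det_symbol a m 0 = [:0, 1:] ^ m"
  by (induction m) (auto intro!: sum.neutral)

lemma det_symbol_cong:
  assumes "\<And>i j. i \<le> j \<Longrightarrow> j + 1 - i \<le> p \<Longrightarrow> a i j = b i j"
  shows "det_symbol a m p = det_symbol b m p"
  using assms
proof (induction m arbitrary: p rule: less_induct)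
  case (less m)
  show ?case
  proof (cases m)
    case (Suc l)
    have "det_symbol a l p = det_symbol b l p"
      using less.prems Suc by (intro less.IH) auto
    moreover have "det_symbol a i (p - (l + 1 - i)) = det_symbol b i (p - (l + 1 - i))"
      if "i \<le> l" for i
      using less.prems Suc that by (intro less.IH) auto
    ultimately show ?thesis
      using less.prems unfolding Suc det_symbol.simps
      by (intro arg_cong2[of _ _ _ _ "(-)"] sum.cong) auto
  qed simp
qed

text \<open>All terms of the recursion that involve shorter diagonals cancel. The remaining one carries
  \<open>d\<^sub>i\<^sub>,\<^sub>0 = z\<^sup>i\<close>, where \<open>i = m + 1 - p\<close> is the row in which column \<open>m\<close> meets the \<open>p\<close>-th diagonal.\<close>

lemma det_symbol_diff:
  assumes agree: "\<And>i j. i \<le> j \<Longrightarrow> j + 1 - i < p \<Longrightarrow> a i j = b i j" and "p \<ge> 1"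
  shows "det_symbol a (Suc m) p - det_symbol b (Suc m) p =
    [:- of_nat p, 1:] * (det_symbol a m p - det_symbol b m p) -
    (if p \<le> m + 1 then smult (a (m + 1 - p) m - b (m + 1 - p) m) ([:0, 1:] ^ (m + 1 - p)) else 0)"
proof -
  define h where "h c i = (if m + 1 - i \<le> p then smult (c i m) (det_symbol c i (p - (m + 1 - i)))
    else 0)" for c i
  have term_diff: "h a i - h b i = (if i = m + 1 - p \<and> p \<le> m + 1
      then smult (a i m - b i m) ([:0, 1:] ^ i) else 0)" if "i \<le> m" for i
  proof -
    have sym: "det_symbol a i (p - (m + 1 - i)) = det_symbol b i (p - (m + 1 - i))"
      using that agree \<open>p \<ge> 1\<close> by (intro det_symbol_cong) simp
    consider "m + 1 - i < p" | "m + 1 - i = p" | "m + 1 - i > p" by linarith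
    then show ?thesis
    proof cases
      case 1
      then have "h a i = h b i"
        unfolding h_def using agree[OF that] sym by simp
      moreover have "\<not> (i = m + 1 - p \<and> p \<le> m + 1)" using 1 by linarith
      ultimately show ?thesis by (simp only: if_False diff_self)
    next
      case 2
      then have "i = m + 1 - p \<and> p \<le> m + 1" using that by linarith
      with 2 show ?thesis
        unfolding h_def by (simp add: det_symbol_0_right smult_diff_left)
    next
      case 3
      then have "\<not> (i = m + 1 - p \<and> p \<le> m + 1)" by linarith
      moreover have "h a i = h b i" using 3 unfolding h_def by simp
      ultimately show ?thesis by (simp only: if_False diff_self)
    qed
  qed
  have "(\<Sum>i\<le>m. h a i) - (\<Sum>i\<le>m. h b i) = (\<Sum>i\<le>m. h a i - h b i)"
    by (simp add: sum_subtractf)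
  also have "\<dots> = (\<Sum>i\<le>m. if i = m + 1 - p then
      (if p \<le> m + 1 then smult (a i m - b i m) ([:0, 1:] ^ i) else 0) else 0)"
    by (intro sum.cong) (auto simp: term_diff)
  also have "\<dots> = (if p \<le> m + 1
      then smult (a (m + 1 - p) m - b (m + 1 - p) m) ([:0, 1:] ^ (m + 1 - p)) else 0)"
    using \<open>p \<ge> 1\<close> by (cases "p \<le> m + 1") auto
  finally have "(\<Sum>i\<le>m. h a i) - (\<Sum>i\<le>m. h b i) = (if p \<le> m + 1
      then smult (a (m + 1 - p) m - b (m + 1 - p) m) ([:0, 1:] ^ (m + 1 - p)) else 0)" .
  moreover have "det_symbol c (Suc m) p = [:- of_nat p, 1:] * det_symbol c m p - (\<Sum>i\<le>m. h c i)"
    for c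
    unfolding h_def by (rule det_symbol.simps(2))
  moreover have "q * v - v' - (q * w - w') = q * (v - w) - (v' - w')"
    for q v v' w w' :: "complex poly"
    by (simp add: right_diff_distrib)
  ultimately show ?thesis by (simp only:)
qed

lemma det_symbol_determines_diagonal:
  assumes agree: "\<And>i j. i \<le> j \<Longrightarrow> j + 1 - i < p \<Longrightarrow> a i j = b i j" and "p \<ge> 1"
    and "det_symbol a N p = det_symbol b N p" and "i + p \<le> N"
  shows "a i (i + p - 1) = b i (i + p - 1)"
  using assms(3,4)
proof (induction N)
  case 0
  then show ?case using \<open>p \<ge> 1\<close> by simp
next
  case (Suc m)
  let ?e = "det_symbol a m p - det_symbol b m p"
  let ?\<delta> = "if p \<le> m + 1 then a (m + 1 - p) m - b (m + 1 - p) m else 0"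
  have eq: "[:- of_nat p, 1:] * ?e - smult ?\<delta> ([:0, 1:] ^ (m + 1 - p)) = 0"
    using det_symbol_diff[of p a b m, OF agree \<open>p \<ge> 1\<close>] Suc.prems(1) by (simp split: if_splits)
  then have "poly ([:- of_nat p, 1:] * ?e - smult ?\<delta> ([:0, 1:] ^ (m + 1 - p))) (of_nat p) = 0"
    by (simp only: poly_0)
  then have \<delta>: "?\<delta> = 0"
    using \<open>p \<ge> 1\<close> by simp
  with eq have "[:- of_nat p, 1:] * ?e = 0"
    by (simp only: smult_0_left diff_zero)
  then have "?e = 0"
    by (simp only: mult_eq_0_iff) simp
  show ?case
  proof (cases "i + p \<le> m")
    case True
    then show ?thesis using Suc.IH \<open>?e = 0\<close> by simp
  next
    case False
    then have "m + 1 - p = i" "m = i + p - 1" "p \<le> m + 1" using Suc.prems(2) by auto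
    then show ?thesis using \<delta> by simp
  qed
qed

text \<open>Comparing two matrices diagonal by diagonal assumes agreement on whole diagonals, including
  the part outside the \<open>N \<times> N\<close> block, about which the symbols of size \<open>N\<close> say nothing. Setting that
  part to zero in both matrices makes it agree, and keeps these symbols.\<close>

lemma det_symbol_restrict:
  "m \<le> N \<Longrightarrow> det_symbol (\<lambda>i j. if j < N then a i j else 0) m p = det_symbol a m p"
proof (induction m arbitrary: p rule: less_induct)
  case (less m)
  then show ?case by (cases m) (auto intro!: sum.cong)
qed

lemma det_symbol_determines_entries:
  assumes "\<And>p. det_symbol a N p = det_symbol b N p" and "i \<le> j" and "j < N"
  shows "a i j = b i j"
proof -
  define a' where "a' = (\<lambda>i j. if j < N then a i j else 0)"
  define b' where "b' = (\<lambda>i j. if j < N then b i j else 0)"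
  have sym: "det_symbol a' N p = det_symbol b' N p" for p
    using assms(1) by (simp add: a'_def b'_def det_symbol_restrict)
  have "a' i j = b' i j" if "i \<le> j" "j + 1 - i = p" for p i j
    using that
  proof (induction p arbitrary: i j rule: less_induct)
    case (less p)
    show ?case
    proof (cases "j < N")
      case True
      have "a' i (i + p - 1) = b' i (i + p - 1)"
        by (rule det_symbol_determines_diagonal[OF less.IH _ sym]) (use less.prems True in auto)
      then show ?thesis using less.prems by auto
    qed (simp add: a'_def b'_def)
  qed
  then have "a' i j = b' i j" using \<open>i \<le> j\<close> by blast
  then show ?thesis using \<open>j < N\<close> by (simp add: a'_def b'_def)
qed

theorem corollary2p6:
  fixes n :: nat
    and A A' :: "complex mat"
    and x x' :: "nat \<Rightarrow> nat \<Rightarrow> complex"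
  assumes "A \<in> carrier_mat (n + 1) (n + 1)" "unit_hessenberg A"
    and "A' \<in> carrier_mat (n + 1) (n + 1)" "unit_hessenberg A'"
    and "det_right ((weyl_u * weyl_ustar) \<cdot>\<^sub>m 1\<^sub>m (n + 1) - weyl_mat A) = weyl_expansion n x"
    and "det_right ((weyl_u * weyl_ustar) \<cdot>\<^sub>m 1\<^sub>m (n + 1) - weyl_mat A') = weyl_expansion n x'"
    and "\<And>p k. 1 \<le> p \<Longrightarrow> p \<le> n + 1 \<Longrightarrow> k \<le> n + 1 - p \<Longrightarrow> x p k = x' p k"
  shows "A = A'"
proof -
  have "weyl_expansion n x = weyl_expansion n x'"
    unfolding weyl_expansion_def using assms(7)
    by (intro arg_cong2[of _ _ _ _ "(+)"] sum.cong) auto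
  then have "lead_det (\<lambda>i j. A $$ (i, j)) (n + 1) = lead_det (\<lambda>i j. A' $$ (i, j)) (n + 1)"
    using assms(5,6) unfolding det_right_weyl_mat[OF assms(1)] det_right_weyl_mat[OF assms(3)]
    by simp
  then have upper: "A $$ (i, j) = A' $$ (i, j)" if "i \<le> j" "j < n + 1" for i j
    using det_symbol_determines_entries[OF det_symbol_determined] that by blast
  show ?thesis
  proof (rule eq_matI)
    fix i j
    assume "i < dim_row A'" "j < dim_col A'"
    then have ij: "i < n + 1" "j < n + 1" using assms(3) by auto
    have lower: "B $$ (i, j) = (if i = j + 1 then 1 else 0)"
      if "B \<in> carrier_mat (n + 1) (n + 1)" "unit_hessenberg B" "\<not> i \<le> j" for B :: "complex mat"
      using that ij unfolding unit_hessenberg_def by fastforce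
    show "A $$ (i, j) = A' $$ (i, j)"
    proof (cases "i \<le> j")
      case True
      then show ?thesis using upper ij by blast
    next
      case False
      then show ?thesis using lower assms(1-4) by simp
    qed
  qed (use assms(1,3) in auto)
qed

end
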